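(* Let $N\ge 1$ and let $\phi_1,\dots,\phi_N$ be plane-wave seed functions $\phi_i=\epsilon_i e^{\mathrm i p_i\cdot X}$ with pairwise distinct $z_1,\dots,z_N$. The complete perturbiner expansion of the Plebański scalar with seed functions $\phi_1,\dots,\phi_N$ is given by the sum over all marked trees $$\Phi(\phi_1,\dots,\phi_N)=\sum_{\mathbf t\in\mathcal T_N}\phi_{\mathbf t}.$$ That is, $\phi:=\sum_{\mathbf t\in\mathcal T_N}\phi_{\mathbf t}$ satisfies Plebański's second heavenly equation $$\Box\phi-\{\partial_u\phi,\partial_w\phi\}=0,$$ and the part of $\phi$ that is linear in the parameters $\epsilon_1,\dots,\epsilon_N$ is $\sum_{i=1}^N\phi_i$.
   Context: Coordinates: $u,\bar u,w,\bar w$ are four independent coordinates ($\bar u,\bar w$ are not to be read as complex conjugates). Define $$\Box=\partial_u\partial_{\bar u}-\partial_w\partial_{\bar w},\qquad \{f,g\}=\partial_uf\,\partial_wg-\partial_wf\,\partial_ug .$$ Null momenta: for each $i$, fix complex numbers $\omega_i\neq0$, $z_i$, $\bar z_i$ ($\bar z_i$ may be treated as independent of $z_i$), and set $z_{ij}=z_i-z_j$ and $p_i\cdot X=\omega_i(u+z_i\bar z_i\bar u-\bar z_iw-z_i\bar w)$. Infinitesimal parameters: $\epsilon_1,\dots,\epsilon_N$ are commuting formal parameters with $\epsilon_i^2=0$, while products of distinct $\epsilon_i$ are nonzero (i.e. all functions take values in $\mathbb C[\epsilon_1,\dots,\epsilon_N]/(\epsilon_1^2,\dots,\epsilon_N^2)$).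 The seed functions are $\phi_i=\epsilon_ie^{\mathrm ip_i\cdot X}$. A perturbiner expansion with seeds $\phi_1,\dots,\phi_N$ is a solution $\phi$ of the full equation of motion $\Box\phi-\{\partial_u\phi,\partial_w\phi\}=0$ whose part linear in the $\epsilon_i$ is $\sum_i\phi_i$; it is denoted $\Phi(\phi_1,\dots,\phi_N)$. Marked trees: $\mathcal T_N$ is the set of all trees (connected acyclic graphs) whose vertex set is a nonempty subset of $\{1,\dots,N\}$ (single-vertex trees included). Operators: $\partial^{(i)}_\mu$ is the derivation acting only on the factor $\phi_i$ of a product of distinct seed functions ($\partial^{(i)}_\mu\phi_i=\partial_\mu\phi_i$, $\partial^{(i)}_\mu\phi_j=0$ for $j\ne i$), and $D^{ij}=\partial_u^{(i)}\partial_w^{(j)}-\partial_u^{(j)}\partial_w^{(i)}$. For $\mathbf t\in\mathcal T_N$, $$\phi_{\mathbf t}=\Big(\prod_{\{i,j\}\in\text{edges}(\mathbf t)}\frac{D^{ij}}{z_{ij}}\Big)\Big(\prod_{k\in\text{nodes}(\mathbf t)}\phi_k\Big),$$ which is well defined since $D^{ij}/z_{ij}$ is symmetric in $i,j$. *)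

theory Defs
  imports "HOL-Analysis.Analysis"
begin

section \<open>The algebra of square-zero parameters\<close>

text \<open>
  An element of \<open>\<complex>[\<epsilon>\<^sub>0, \<epsilon>\<^sub>1, \<dots>] / (\<epsilon>\<^sub>i\<^sup>2)\<close> is given by its coefficients on the monomials
  \<open>\<epsilon>\<^sub>S = \<Prod>i\<in>S. \<epsilon>\<^sub>i\<close>, \<open>S\<close> a finite set; the relations \<open>\<epsilon>\<^sub>i\<^sup>2 = 0\<close> turn the product into
  a convolution over the splittings of \<open>S\<close> into two disjoint parts. (Infinitely many nonzero
  coefficients are allowed; in \<open>eps_algebra N\<close> below there are at most \<open>2\<^sup>N\<close>.)
\<close>

typedef epsalg = "{f :: nat set \<Rightarrow> complex. \<forall>S. infinite S \<longrightarrow> f S = 0}"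
  morphisms coeff Abs_epsalg
  by (rule exI[of _ "\<lambda>_. 0"]) simp

setup_lifting type_definition_epsalg

lemma epsalg_eqI: "(\<And>S. finite S \<Longrightarrow> coeff a S = coeff b S) \<Longrightarrow> a = b"
  by transfer (metis ext)

instantiation epsalg :: comm_ring_1
begin

lift_definition zero_epsalg :: epsalg is "\<lambda>_. 0" by simp
lift_definition one_epsalg :: epsalg is "\<lambda>S. if S = {} then 1 else 0" by auto
lift_definition plus_epsalg :: "epsalg \<Rightarrow> epsalg \<Rightarrow> epsalg" is "\<lambda>a b S. a S + b S" by simp
lift_definition minus_epsalg :: "epsalg \<Rightarrow> epsalg \<Rightarrow> epsalg" is "\<lambda>a b S. a S - b S" by simp
lift_definition uminus_epsalg :: "epsalg \<Rightarrow> epsalg" is "\<lambda>a S. - a S" by simp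
lift_definition times_epsalg :: "epsalg \<Rightarrow> epsalg \<Rightarrow> epsalg"
  is "\<lambda>a b S. \<Sum>T\<in>Pow S. a T * b (S - T)" by simp

instance
proof
  fix a b c :: epsalg
  show "a * b * c = a * (b * c)"
  proof (rule epsalg_eqI)
    fix S :: "nat set" assume S: "finite S"
    have "coeff (a * b * c) S =
        (\<Sum>T\<in>Pow S. \<Sum>R\<in>Pow T. coeff a R * coeff b (T - R) * coeff c (S - T))"
      by (simp add: times_epsalg.rep_eq sum_distrib_right)
    also have "\<dots> = (\<Sum>(T,R)\<in>(SIGMA T:Pow S. Pow T). coeff a R * coeff b (T - R) * coeff c (S - T))"
      by (rule sum.Sigma) (use S finite_subset in auto)
    also have "\<dots> = (\<Sum>(R,Q)\<in>(SIGMA R:Pow S. Pow (S - R)). coeff a R * (coeff b Q * coeff c (S - R - Q)))"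
    proof (rule sum.reindex_bij_witness[where i = "\<lambda>(R,Q). (R \<union> Q, R)" and j = "\<lambda>(T,R). (R, T - R)"])
      fix p assume "p \<in> (SIGMA T:Pow S. Pow T)"
      then obtain T R where p: "p = (T,R)" "T \<subseteq> S" "R \<subseteq> T" by auto
      then have "S - R - (T - R) = S - T" by auto
      with p show "(case case p of (T, R) \<Rightarrow> (R, T - R) of (R, Q) \<Rightarrow> coeff a R * (coeff b Q * coeff c (S - R - Q)))
          = (case p of (T, R) \<Rightarrow> coeff a R * coeff b (T - R) * coeff c (S - T))"
        by (simp add: mult.assoc)
    qed auto
    also have "\<dots> = (\<Sum>R\<in>Pow S. \<Sum>Q\<in>Pow (S - R). coeff a R * (coeff b Q * coeff c (S - R - Q)))"
      by (rule sum.Sigma[symmetric]) (use S in auto)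
    also have "\<dots> = coeff (a * (b * c)) S"
      by (simp add: times_epsalg.rep_eq sum_distrib_left)
    finally show "coeff (a * b * c) S = coeff (a * (b * c)) S" .
  qed
  show "a * b = b * a"
  proof (rule epsalg_eqI)
    fix S :: "nat set"
    show "coeff (a * b) S = coeff (b * a) S"
      unfolding times_epsalg.rep_eq
      by (rule sum.reindex_bij_witness[where i = "\<lambda>T. S - T" and j = "\<lambda>T. S - T"])
        (auto simp: double_diff mult.commute)
  qed
  show "1 * a = a"
  proof (rule epsalg_eqI)
    fix S :: "nat set" assume S: "finite S"
    have "coeff (1 * a) S = (\<Sum>T\<in>Pow S. if T = {} then coeff a S else 0)"
      unfolding times_epsalg.rep_eq one_epsalg.rep_eq by (rule sum.cong) auto
    also have "\<dots> = coeff a S" using S by simp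
    finally show "coeff (1 * a) S = coeff a S" .
  qed
  show "(a + b) * c = a * c + b * c"
    by (rule epsalg_eqI) (simp add: times_epsalg.rep_eq plus_epsalg.rep_eq sum.distrib distrib_right)
  show "(0::epsalg) \<noteq> 1" by transfer (metis one_neq_zero)
qed (transfer; simp add: fun_eq_iff)+

end

lift_definition eps :: "nat \<Rightarrow> epsalg" is "\<lambda>i S. if S = {i} then 1 else 0" by auto

lift_definition scaleE :: "complex \<Rightarrow> epsalg \<Rightarrow> epsalg" is "\<lambda>c a S. c * a S" by simp

text \<open>The subalgebra \<open>\<complex>[\<epsilon>\<^sub>1, \<dots>, \<epsilon>\<^sub>N] / (\<epsilon>\<^sub>1\<^sup>2, \<dots>, \<epsilon>\<^sub>N\<^sup>2)\<close>.\<close>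

definition eps_algebra :: "nat \<Rightarrow> epsalg set" where
  "eps_algebra N = {a. \<forall>S. \<not> S \<subseteq> {1..N} \<longrightarrow> coeff a S = 0}"

lift_definition linear_part :: "epsalg \<Rightarrow> epsalg" is "\<lambda>a S. if card S = 1 then a S else 0" by simp

lemma eps_square: "eps i * eps i = 0"
  by (rule epsalg_eqI)
    (auto simp: times_epsalg.rep_eq eps.rep_eq zero_epsalg.rep_eq intro!: sum.neutral)

lemma coeff_prod_eps:
  assumes "finite V"
  shows "coeff (\<Prod>i\<in>V. eps i) S = (if S = V then 1 else 0)"
  using assms
proof (induction V arbitrary: S rule: finite_induct)
  case empty
  then show ?case by (simp add: one_epsalg.rep_eq)
next
  case (insert i V)
  show ?case
  proof (cases "finite S")
    case True
    have "coeff (\<Prod>i\<in>insert i V. eps i) S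
        = (\<Sum>T\<in>Pow S. (if T = {i} then 1 else 0) * (if S - T = V then 1 else 0))"
      using insert by (simp add: times_epsalg.rep_eq eps.rep_eq)
    also have "\<dots> = (\<Sum>T\<in>Pow S. if T = {i} then (if S - {i} = V then 1 else 0) else 0)"
      by (rule sum.cong) auto
    also have "\<dots> = (if i \<in> S \<and> S - {i} = V then 1 else 0)"
      using True by simp
    also have "\<dots> = (if S = insert i V then 1 else 0)"
      using insert.hyps by auto
    finally show ?thesis .
  next
    case False
    moreover have "finite (insert i V)" using insert by simp
    ultimately show ?thesis by (auto simp: times_epsalg.rep_eq insert.hyps)
  qed
qed


section \<open>Fields on complexified space-time and the second heavenly equation\<close>

text \<open>
  The four coordinates are independent complex coordinates; partial derivatives are
  complex derivatives, taken coefficientwise in the parameters.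
\<close>

datatype coord = CU | CUbar | CW | CWbar

type_synonym point = "coord \<Rightarrow> complex"
type_synonym field_fun = "point \<Rightarrow> epsalg"

lift_definition derivE :: "(complex \<Rightarrow> epsalg) \<Rightarrow> complex \<Rightarrow> epsalg"
  is "\<lambda>f t S. deriv (\<lambda>s. f s S) t"
  by simp

definition pd :: "coord \<Rightarrow> field_fun \<Rightarrow> field_fun" where
  "pd m f X = derivE (\<lambda>t. f (X(m := t))) (X m)"

definition wave_op :: "field_fun \<Rightarrow> field_fun" where
  "wave_op f X = pd CU (pd CUbar f) X - pd CW (pd CWbar f) X"

definition poisson :: "field_fun \<Rightarrow> field_fun \<Rightarrow> field_fun" where
  "poisson f g X = pd CU f X * pd CW g X - pd CW f X * pd CU g X"

text \<open>
  Since \<^const>\<open>deriv\<close> is total, a solution is also required to have complex partial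
  derivatives of all orders.
\<close>

definition smooth_field :: "field_fun \<Rightarrow> bool" where
  "smooth_field f \<longleftrightarrow> (\<forall>ms m X S.
     (\<lambda>t. coeff (foldr pd ms f (X(m := t))) S) field_differentiable at (X m))"

definition plebanski_solution :: "field_fun \<Rightarrow> bool" where
  "plebanski_solution f \<longleftrightarrow>
     smooth_field f \<and> (\<forall>X. wave_op f X - poisson (pd CU f) (pd CW f) X = 0)"

definition is_perturbiner :: "nat \<Rightarrow> (nat \<Rightarrow> field_fun) \<Rightarrow> field_fun \<Rightarrow> bool" where
  "is_perturbiner N \<phi> \<Phi> \<longleftrightarrow>
     (\<forall>X. \<Phi> X \<in> eps_algebra N) \<and> plebanski_solution \<Phi> \<and>
     (\<forall>X. linear_part (\<Phi> X) = (\<Sum>i=1..N. \<phi> i X))"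


section \<open>Plane waves\<close>

definition mom_dot ::
  "(nat \<Rightarrow> complex) \<Rightarrow> (nat \<Rightarrow> complex) \<Rightarrow> (nat \<Rightarrow> complex) \<Rightarrow> nat \<Rightarrow> point \<Rightarrow> complex" where
  "mom_dot \<omega> z zb i X = \<omega> i * (X CU + z i * zb i * X CUbar - zb i * X CW - z i * X CWbar)"

definition plane_wave ::
  "(nat \<Rightarrow> complex) \<Rightarrow> (nat \<Rightarrow> complex) \<Rightarrow> (nat \<Rightarrow> complex) \<Rightarrow> nat \<Rightarrow> field_fun" where
  "plane_wave \<omega> z zb i X = scaleE (exp (\<i> * mom_dot \<omega> z zb i X)) (eps i)"


section \<open>Marked trees\<close>

text \<open>
  A simple graph is a pair \<open>(V, E)\<close> with \<open>E\<close> a set of two-element subsets of \<open>V\<close>.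
\<close>

definition is_cycle :: "nat set set \<Rightarrow> nat list \<Rightarrow> bool" where
  "is_cycle E c \<longleftrightarrow> length c \<ge> 3 \<and> distinct c \<and>
     (\<forall>k<length c. {c ! k, c ! (Suc k mod length c)} \<in> E)"

definition is_tree :: "nat set \<Rightarrow> nat set set \<Rightarrow> bool" where
  "is_tree V E \<longleftrightarrow>
     V \<noteq> {} \<and> (\<forall>e\<in>E. e \<subseteq> V \<and> card e = 2) \<and>
     (\<forall>x\<in>V. \<forall>y\<in>V. (x, y) \<in> {(a, b). {a, b} \<in> E}\<^sup>*) \<and>
     (\<nexists>c. is_cycle E c)"

definition marked_trees :: "nat \<Rightarrow> (nat set \<times> nat set set) set" where
  "marked_trees N = {(V, E). V \<subseteq> {1..N} \<and> is_tree V E}"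

lemma finite_marked_trees: "finite (marked_trees N)"
proof (rule finite_subset)
  show "marked_trees N \<subseteq> Pow {1..N} \<times> Pow (Pow {1..N})"
    unfolding marked_trees_def is_tree_def by blast
qed simp


section \<open>The operators acting on single factors\<close>

text \<open>
  An operator acting on one factor only is not a function of the value of a product, so products
  of seeds are first point-split: \<open>\<Prod>k. \<phi>\<^sub>k(X)\<close> is the restriction to the diagonal of
  the function \<open>Y \<mapsto> \<Prod>k. \<phi>\<^sub>k(Y\<^sub>k)\<close>, on which \<open>\<partial>\<^bsub>m\<^esub>\<close> acting on the factor \<open>i\<close>
  is the partial derivative in the coordinate \<open>m\<close> of the point \<open>Y\<^sub>i\<close>; the lemma
  \<open>factor_pd_prod\<close> states that it does act like this.
\<close>

type_synonym split_fun = "(nat \<Rightarrow> point) \<Rightarrow> epsalg"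

definition factor_pd :: "nat \<Rightarrow> coord \<Rightarrow> split_fun \<Rightarrow> split_fun" where
  "factor_pd i m G Y = derivE (\<lambda>t. G (Y(i := (Y i)(m := t)))) (Y i m)"

lemma factor_pd_prod:
  assumes "finite V" "i \<in> V"
    and diff: "\<And>S. (\<lambda>t. coeff (f i ((Y i)(m := t))) S) field_differentiable at (Y i m)"
  shows "factor_pd i m (\<lambda>Y. \<Prod>k\<in>V. f k (Y k)) Y = pd m (f i) (Y i) * (\<Prod>k\<in>V - {i}. f k (Y k))"
proof (rule epsalg_eqI)
  fix S :: "nat set" assume S: "finite S"
  define r where "r = (\<Prod>k\<in>V - {i}. f k (Y k))"
  have split: "(\<Prod>k\<in>V. f k ((Y(i := (Y i)(m := t))) k)) = f i ((Y i)(m := t)) * r" for t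
  proof -
    have "(\<Prod>k\<in>V - {i}. f k ((Y(i := (Y i)(m := t))) k)) = r"
      unfolding r_def by (rule prod.cong) auto
    then show ?thesis by (simp add: prod.remove[OF assms(1,2)])
  qed
  have "((\<lambda>t. \<Sum>T\<in>Pow S. coeff (f i ((Y i)(m := t))) T * coeff r (S - T)) has_field_derivative
      (\<Sum>T\<in>Pow S. deriv (\<lambda>t. coeff (f i ((Y i)(m := t))) T) (Y i m) * coeff r (S - T))) (at (Y i m))"
    by (intro DERIV_sum DERIV_cmult_right) (use diff DERIV_deriv_iff_field_differentiable in blast)
  from DERIV_imp_deriv[OF this]
  show "coeff (factor_pd i m (\<lambda>Y. \<Prod>k\<in>V. f k (Y k)) Y) S
      = coeff (pd m (f i) (Y i) * (\<Prod>k\<in>V - {i}. f k (Y k))) S"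
    unfolding factor_pd_def pd_def derivE.rep_eq split times_epsalg.rep_eq r_def[symmetric] .
qed

definition D_op :: "nat \<Rightarrow> nat \<Rightarrow> split_fun \<Rightarrow> split_fun" where
  "D_op i j G Y =
     factor_pd i CU (factor_pd j CW G) Y - factor_pd j CU (factor_pd i CW G) Y"

definition propagator :: "(nat \<Rightarrow> complex) \<Rightarrow> nat \<Rightarrow> nat \<Rightarrow> split_fun \<Rightarrow> split_fun" where
  "propagator z i j G Y = scaleE (1 / (z i - z j)) (D_op i j G Y)"

text \<open>
  Thus the propagator of an edge \<open>e = {i, j}\<close> may be written with \<open>i = Min e\<close>, \<open>j = Max e\<close>.
\<close>

lemma propagator_sym: "propagator z i j = propagator z j i"
proof (intro ext epsalg_eqI)
  fix G Y S
  have "1 / (z i - z j) = - (1 / (z j - z i))"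
    by (metis minus_diff_eq minus_divide_right)
  then show "coeff (propagator z i j G Y) S = coeff (propagator z j i G Y) S"
    by (simp add: propagator_def D_op_def scaleE.rep_eq minus_epsalg.rep_eq algebra_simps)
qed

text \<open>
  The edge operators are composed with \<^const>\<open>Finite_Set.fold\<close>. They commute on the functions
  obtained from products of plane waves, so the order of composition is irrelevant: see
  \<open>tree_term_plane_wave\<close> below.
\<close>

definition tree_term ::
  "(nat \<Rightarrow> complex) \<Rightarrow> (nat \<Rightarrow> field_fun) \<Rightarrow> nat set \<times> nat set set \<Rightarrow> field_fun" where
  "tree_term z \<phi> t X = (case t of (V, E) \<Rightarrow>
     Finite_Set.fold (\<lambda>e. propagator z (Min e) (Max e)) (\<lambda>Y. \<Prod>k\<in>V. \<phi> k (Y k)) E (\<lambda>_. X))"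

lemma scaleE_simps:
  "scaleE a (scaleE b x) = scaleE (a * b) x"
  "scaleE a x - scaleE b x = scaleE (a - b) x"
  "scaleE a x * scaleE b y = scaleE (a * b) (x * y)"
  "scaleE 1 x = x"
  by (rule epsalg_eqI; simp add: scaleE.rep_eq minus_epsalg.rep_eq times_epsalg.rep_eq
      algebra_simps sum_distrib_left)+

lemma prod_plane_wave:
  "finite V \<Longrightarrow> (\<Prod>k\<in>V. plane_wave \<omega> z zb k (Y k))
     = scaleE (exp (\<Sum>k\<in>V. \<i> * mom_dot \<omega> z zb k (Y k))) (\<Prod>k\<in>V. eps k)"
  by (induction V rule: finite_induct)
    (simp_all add: plane_wave_def scaleE_simps exp_add)

fun mom_comp :: "complex \<Rightarrow> complex \<Rightarrow> complex \<Rightarrow> coord \<Rightarrow> complex" where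
  "mom_comp \<omega> z zb CU = \<omega>"
| "mom_comp \<omega> z zb CUbar = \<omega> * z * zb"
| "mom_comp \<omega> z zb CW = - \<omega> * zb"
| "mom_comp \<omega> z zb CWbar = - \<omega> * z"

lemma factor_pd_plane_waves:
  assumes "finite V" "i \<in> V"
  shows "factor_pd i m (\<lambda>Y. scaleE c (\<Prod>k\<in>V. plane_wave \<omega> z zb k (Y k)))
    = (\<lambda>Y. scaleE (\<i> * mom_comp (\<omega> i) (z i) (zb i) m * c) (\<Prod>k\<in>V. plane_wave \<omega> z zb k (Y k)))"
proof (intro ext epsalg_eqI)
  fix Y :: "nat \<Rightarrow> point" and S :: "nat set"
  define r where "r = (\<Sum>k\<in>V - {i}. \<i> * mom_dot \<omega> z zb k (Y k))"
  have split: "(\<Sum>k\<in>V. \<i> * mom_dot \<omega> z zb k ((Y(i := x)) k)) = \<i> * mom_dot \<omega> z zb i x + r" for x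
  proof -
    have "(\<Sum>k\<in>V - {i}. \<i> * mom_dot \<omega> z zb k ((Y(i := x)) k)) = r"
      unfolding r_def by (rule sum.cong) auto
    then show ?thesis by (simp add: sum.remove[OF assms])
  qed
  have lin: "((\<lambda>t. mom_dot \<omega> z zb i ((Y i)(m := t))) has_field_derivative
      mom_comp (\<omega> i) (z i) (zb i) m) (at (Y i m))"
    unfolding mom_dot_def by (cases m) (auto intro!: derivative_eq_intros)
  define e where "e = coeff (\<Prod>k\<in>V. eps k) S"
  have "((\<lambda>t. c * (exp (\<i> * mom_dot \<omega> z zb i ((Y i)(m := t)) + r) * e)) has_field_derivative
      \<i> * mom_comp (\<omega> i) (z i) (zb i) m * c * (exp (\<i> * mom_dot \<omega> z zb i (Y i) + r) * e))
      (at (Y i m))"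
    by (rule derivative_eq_intros lin refl)+ simp
  from DERIV_imp_deriv[OF this]
  show "coeff (factor_pd i m (\<lambda>Y. scaleE c (\<Prod>k\<in>V. plane_wave \<omega> z zb k (Y k))) Y) S
    = coeff (scaleE (\<i> * mom_comp (\<omega> i) (z i) (zb i) m * c) (\<Prod>k\<in>V. plane_wave \<omega> z zb k (Y k))) S"
    using split[of "Y i"]
    by (simp add: factor_pd_def derivE.rep_eq prod_plane_wave[OF assms(1)] scaleE.rep_eq split e_def
        del: fun_upd_apply)
qed

lemma propagator_plane_waves:
  assumes "finite V" "i \<in> V" "j \<in> V"
  shows "propagator z i j (\<lambda>Y. scaleE c (\<Prod>k\<in>V. plane_wave \<omega> z zb k (Y k)))
    = (\<lambda>Y. scaleE (\<omega> i * \<omega> j * (zb j - zb i) / (z i - z j) * c)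
         (\<Prod>k\<in>V. plane_wave \<omega> z zb k (Y k)))"
proof
  fix Y
  have "1 / (z i - z j) * (\<i> * \<omega> i * (\<i> * (- \<omega> j * zb j) * c) - \<i> * \<omega> j * (\<i> * (- \<omega> i * zb i) * c))
      = \<omega> i * \<omega> j * (zb j - zb i) / (z i - z j) * c"
    by (simp add: field_simps)
  then show "propagator z i j (\<lambda>Y. scaleE c (\<Prod>k\<in>V. plane_wave \<omega> z zb k (Y k))) Y
    = scaleE (\<omega> i * \<omega> j * (zb j - zb i) / (z i - z j) * c)
         (\<Prod>k\<in>V. plane_wave \<omega> z zb k (Y k))"
    unfolding propagator_def D_op_def
    by (simp only: factor_pd_plane_waves[OF assms(1,2)] factor_pd_plane_waves[OF assms(1,3)]
        scaleE_simps mom_comp.simps)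
qed

lemma tree_term_plane_wave:
  assumes "finite V" and E: "\<And>e. e \<in> E \<Longrightarrow> e \<subseteq> V \<and> card e = 2"
  shows "tree_term z (plane_wave \<omega> z zb) (V, E) X
    = scaleE (\<Prod>e\<in>E. \<omega> (Min e) * \<omega> (Max e) * (zb (Max e) - zb (Min e)) / (z (Min e) - z (Max e)))
        (\<Prod>k\<in>V. plane_wave \<omega> z zb k X)"
proof -
  define P where "P c = (\<lambda>Y. scaleE c (\<Prod>k\<in>V. plane_wave \<omega> z zb k (Y k)))" for c
  define q where
    "q e = \<omega> (Min e) * \<omega> (Max e) * (zb (Max e) - zb (Min e)) / (z (Min e) - z (Max e))" for e
  define F where "F e = propagator z (Min e) (Max e)" for e
  have step: "F e (P c) = P (q e * c)" if "e \<in> E" for e c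
  proof -
    from E[OF that] have "finite e" "e \<noteq> {}" "e \<subseteq> V"
      using assms(1) finite_subset by auto
    then have "Min e \<in> V" "Max e \<in> V" using Min_in Max_in by blast+
    then show ?thesis
      unfolding F_def P_def q_def by (rule propagator_plane_waves[OF assms(1)])
  qed
  have graph: "fold_graph F (P 1) A y \<Longrightarrow> A \<subseteq> E \<Longrightarrow> y = P (\<Prod>e\<in>A. q e)" for A y
  proof (induction rule: fold_graph.induct)
    case (insertI e A y)
    have "finite A" using insertI.hyps(2) by (induction rule: fold_graph.induct) auto
    with insertI step show ?case by auto
  qed simp
  have fin: "finite E"
    by (rule finite_subset[of _ "Pow V"]) (use E assms(1) in auto)
  from finite_imp_fold_graph[OF fin, of F "P 1"] obtain y where "fold_graph F (P 1) E y" by blast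
  with graph fin have "Finite_Set.fold F (P 1) E = P (\<Prod>e\<in>E. q e)"
    unfolding Finite_Set.fold_def by (auto intro!: the_equality)
  then show ?thesis
    by (simp add: tree_term_def F_def[abs_def] P_def q_def scaleE_simps)
qed

end

theory Submission
  imports Defs
begin

text \<open>
  Let \<open>A V\<close> be the sum, over the trees on a vertex set \<open>V\<close>, of the products of the edge weights
  \<open>w\<^bsub>ij\<^esub> = D\<^sup>i\<^sup>j / z\<^bsub>ij\<^esub>\<close>. On the monomial \<open>\<epsilon>\<^sub>V\<close> the heavenly equation becomes
  \<open>\<Sum>\<^bsub>T \<union> T' = V\<^esub> A T * A T' * (\<Sum>\<^bsub>i\<in>T, j\<in>T'\<^esub> w\<^bsub>ij\<^esub> z\<^bsub>ij\<^esub>)\<^sup>2 = A V * \<Sum>\<^bsub>i,j\<in>V\<^esub> w\<^bsub>ij\<^esub> z\<^bsub>ij\<^esub>\<^sup>2\<close>,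
  which holds for arbitrary weights. Its only combinatorial input is that a tree on \<open>V\<close> with
  \<open>a \<noteq> b\<close> decomposes uniquely by cutting the first edge on the path from \<open>a\<close> to \<open>b\<close>; this says
  that, up to terms constant in one index, the matrix of two-component forests inverts the
  weighted graph Laplacian, with factor \<open>A V\<close>.
\<close>

section \<open>Splitting and joining trees\<close>

definition adj :: "nat set set \<Rightarrow> (nat \<times> nat) set" where
  "adj E = {(a, b). {a, b} \<in> E}"

lemma adj_iff [simp]: "(a, b) \<in> adj E \<longleftrightarrow> {a, b} \<in> E"
  by (simp add: adj_def)

lemma reach_sym: "(x, y) \<in> (adj E)\<^sup>* \<Longrightarrow> (y, x) \<in> (adj E)\<^sup>*"
  by (rule symD[OF sym_rtrancl]) (auto simp: sym_def insert_commute)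

lemma reach_mono: "(x, y) \<in> (adj E)\<^sup>* \<Longrightarrow> E \<subseteq> F \<Longrightarrow> (x, y) \<in> (adj F)\<^sup>*"
  using rtrancl_mono[of "adj E" "adj F"] by (auto simp: adj_def)

lemma rtrancl_imp_distinct_path:
  assumes "(x, y) \<in> R\<^sup>*"
  obtains p where "p \<noteq> []" "hd p = x" "last p = y" "distinct p"
    "successively (\<lambda>a b. (a, b) \<in> R) p"
proof -
  from assms have "\<exists>p. p \<noteq> [] \<and> hd p = x \<and> last p = y \<and> distinct p
      \<and> successively (\<lambda>a b. (a, b) \<in> R) p"
  proof (induction rule: converse_rtrancl_induct)
    case base
    show ?case by (rule exI[of _ "[y]"]) simp
  next
    case (step x x')
    then obtain p where p: "p \<noteq> []" "hd p = x'" "last p = y" "distinct p"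
      "successively (\<lambda>a b. (a, b) \<in> R) p" by blast
    show ?case
    proof (cases "x \<in> set p")
      case True
      \<comment> \<open>The walk returns to \<open>x\<close>: the part of \<open>p\<close> before
        \<open>x\<close> is dropped, which keeps the vertices distinct.\<close>
      then obtain us vs where "p = us @ x # vs" by (auto simp: in_set_conv_decomp)
      with p show ?thesis
        by (intro exI[of _ "x # vs"]) (auto simp: successively_append_iff)
    next
      case False
      with p step.hyps show ?thesis
        by (intro exI[of _ "x # p"]) (cases p; auto)
    qed
  qed
  with that show thesis by blast
qed

section \<open>Acyclicity as the condition that every edge is a bridge\<close>

definition all_bridges :: "nat set set \<Rightarrow> bool" where
  "all_bridges E \<longleftrightarrow> (\<forall>x y. {x, y} \<in> E \<longrightarrow> (x, y) \<notin> (adj (E - {{x, y}}))\<^sup>*)"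

lemma all_bridgesD: "all_bridges E \<Longrightarrow> {x, y} \<in> E \<Longrightarrow> (x, y) \<notin> (adj (E - {{x, y}}))\<^sup>*"
  by (simp add: all_bridges_def)

lemma all_bridges_mono: "all_bridges F \<Longrightarrow> E \<subseteq> F \<Longrightarrow> all_bridges E"
  unfolding all_bridges_def by (meson Diff_mono order_refl reach_mono subsetD)

text \<open>An edge lies on a cycle exactly when its ends stay connected after its removal. The
  reachability form replaces vertex lists in all later arguments on joining and cutting.\<close>

lemma no_cycle_iff_all_bridges:
  assumes card2: "\<And>e. e \<in> E \<Longrightarrow> card e = 2"
  shows "(\<nexists>c. is_cycle E c) \<longleftrightarrow> all_bridges E"
proof (intro iffI notI)
  assume acyc: "\<nexists>c. is_cycle E c"
  show "all_bridges E"
    unfolding all_bridges_def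
  proof (intro allI impI notI)
    fix x y
    assume e: "{x, y} \<in> E" and r: "(x, y) \<in> (adj (E - {{x, y}}))\<^sup>*"
    from card2[OF e] have "x \<noteq> y" by auto
    from r obtain p where p: "p \<noteq> []" "hd p = x" "last p = y" "distinct p"
      and succ: "successively (\<lambda>a b. (a, b) \<in> adj (E - {{x, y}})) p"
      by (rule rtrancl_imp_distinct_path)
    have step: "{p ! k, p ! Suc k} \<in> E - {{x, y}}" if "Suc k < length p" for k
      using succ that by (simp add: successively_conv_nth)
    have ends: "p ! 0 = x" "p ! (length p - 1) = y"
      using p by (simp_all add: hd_conv_nth last_conv_nth)
    \<comment> \<open>Length 1 would force \<open>x = y\<close>, and length 2 would use the deleted
      edge; so the path closed by \<open>{x, y}\<close> meets the length bound in
      \<open>is_cycle\<close>.\<close>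
    have "length p \<noteq> 1" using ends \<open>x \<noteq> y\<close> by auto
    moreover have "length p \<noteq> 2" using step[of 0] ends by auto
    ultimately have len: "length p \<ge> 3" using p(1)
      by (metis One_nat_def Suc_1 Suc_leI le_neq_implies_less length_greater_0_conv numeral_3_eq_3)
    have "{p ! k, p ! (Suc k mod length p)} \<in> E" if "k < length p" for k
    proof (cases "Suc k < length p")
      case True
      with step[OF True] show ?thesis by simp
    next
      case False
      with that have "Suc k = length p" by simp
      moreover from this have "k = length p - 1" by simp
      ultimately show ?thesis using ends e by (simp add: insert_commute)
    qed
    with len p have "is_cycle E p" by (simp add: is_cycle_def)
    with acyc show False by blast
  qed
next
  assume br: "all_bridges E" and "\<exists>c. is_cycle E c"
  then obtain c where len: "length c \<ge> 3" and dist: "distinct c"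
    and edge: "\<And>k. k < length c \<Longrightarrow> {c ! k, c ! (Suc k mod length c)} \<in> E"
    by (auto simp: is_cycle_def)
  define n where "n = length c - 1"
  have n: "n \<ge> 2" "length c = Suc n" using len by (auto simp: n_def)
  \<comment> \<open>The cycle without its closing edge is a detour between the ends of that edge. As
    \<open>n\<close> is at least 2 and the entries are distinct, no earlier edge coincides with the
    closing one.\<close>
  have "(c ! 0, c ! k) \<in> (adj (E - {{c ! 0, c ! n}}))\<^sup>*" if "k \<le> n" for k
    using that
  proof (induction k)
    case (Suc k)
    have "{c ! k, c ! Suc k} \<noteq> {c ! 0, c ! n}"
      using Suc.prems n dist by (auto simp: doubleton_eq_iff nth_eq_iff_index_eq)
    moreover have "{c ! k, c ! Suc k} \<in> E"
      using edge[of k] Suc.prems n by simp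
    ultimately have "(c ! k, c ! Suc k) \<in> adj (E - {{c ! 0, c ! n}})" by simp
    with Suc show ?case by (meson Suc_leD rtrancl.rtrancl_into_rtrancl)
  qed simp
  moreover have "{c ! 0, c ! n} \<in> E"
    using edge[of n] n by (simp add: insert_commute)
  ultimately show False using all_bridgesD[OF br] by blast
qed

lemma is_tree_iff:
  "is_tree V E \<longleftrightarrow> V \<noteq> {} \<and> (\<forall>e\<in>E. e \<subseteq> V \<and> card e = 2) \<and>
     (\<forall>x\<in>V. \<forall>y\<in>V. (x, y) \<in> (adj E)\<^sup>*) \<and> all_bridges E"
  using no_cycle_iff_all_bridges[of E] unfolding is_tree_def adj_def by blast

lemma
  assumes "is_tree V E"
  shows is_tree_edge: "e \<in> E \<Longrightarrow> e \<subseteq> V" "e \<in> E \<Longrightarrow> card e = 2"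
    and is_tree_reach: "x \<in> V \<Longrightarrow> y \<in> V \<Longrightarrow> (x, y) \<in> (adj E)\<^sup>*"
    and is_tree_bridges: "all_bridges E"
  using iffD1[OF is_tree_iff assms] by simp_all

section \<open>Joining two trees by an edge\<close>

lemma reach_closed:
  assumes "(x, y) \<in> (adj E)\<^sup>*" "x \<in> C"
    and "\<And>a b. {a, b} \<in> E \<Longrightarrow> a \<in> C \<Longrightarrow> b \<in> C"
  shows "y \<in> C"
  using assms(1)
proof (induction rule: rtrancl_induct)
  case (step u v)
  then show ?case using assms(3)[of u v] by simp
qed (rule assms(2))

text \<open>Contracting \<open>V2\<close> to the vertex \<open>j\<close> maps a walk in the joined graph to a walk in \<open>E1\<close>.\<close>

lemma join_bridge:
  assumes t1: "is_tree V1 E1" and t2: "is_tree V2 E2" and disj: "V1 \<inter> V2 = {}"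
    and j: "j \<in> V1" and a: "a \<in> V2" and e: "{x, y} \<in> E1"
  shows "(x, y) \<notin> (adj (insert {a, j} (E1 \<union> E2) - {{x, y}}))\<^sup>*"
proof
  define \<pi> where "\<pi> v = (if v \<in> V1 then v else j)" for v
  have xy: "x \<in> V1" "y \<in> V1" using is_tree_edge(1)[OF t1 e] by auto
  define F where "F = E1 - {{x, y}}"
  assume "(x, y) \<in> (adj (insert {a, j} (E1 \<union> E2) - {{x, y}}))\<^sup>*"
  then have "(x, y) \<in> (adj (insert {a, j} (F \<union> E2)))\<^sup>*"
    by (rule reach_mono) (auto simp: F_def)
  then have "(x, \<pi> y) \<in> (adj F)\<^sup>*"
  proof (induction rule: rtrancl_induct)
    case base
    show ?case using xy by (simp add: \<pi>_def)
  next
    case (step u v)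
    then consider "{u, v} = {a, j}" | "{u, v} \<in> F" | "{u, v} \<in> E2" by auto
    then show ?case
    proof cases
      case 1
      then have "\<pi> u = \<pi> v" using disj a j by (auto simp: \<pi>_def doubleton_eq_iff)
      with step.IH show ?thesis by simp
    next
      case 2
      then have "\<pi> u = u" "\<pi> v = v"
        using is_tree_edge(1)[OF t1, of "{u, v}"] by (auto simp: \<pi>_def F_def)
      moreover from 2 have "(u, v) \<in> adj F" by simp
      ultimately show ?thesis using step.IH by (metis rtrancl.rtrancl_into_rtrancl)
    next
      case 3
      then have "\<pi> u = \<pi> v"
        using is_tree_edge(1)[OF t2, of "{u, v}"] disj by (auto simp: \<pi>_def)
      with step.IH show ?thesis by simp
    qed
  qed
  with xy all_bridgesD[OF is_tree_bridges[OF t1] e] show False by (simp add: \<pi>_def F_def)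
qed

text \<open>The new edge is the only connection between the disjoint vertex sets, hence a bridge. An
  old edge stays a bridge by \<open>join_bridge\<close>, applied with the two trees exchanged for
  the edges of \<open>E2\<close>.\<close>

lemma is_tree_join:
  assumes t1: "is_tree V1 E1" and t2: "is_tree V2 E2" and disj: "V1 \<inter> V2 = {}"
    and j: "j \<in> V1" and a: "a \<in> V2"
  shows "is_tree (V1 \<union> V2) (insert {a, j} (E1 \<union> E2))"
  unfolding is_tree_iff
proof (intro conjI ballI)
  let ?E = "insert {a, j} (E1 \<union> E2)"
  show "V1 \<union> V2 \<noteq> {}" using j by auto
  have "a \<noteq> j" using a j disj by auto
  show "e \<subseteq> V1 \<union> V2" if "e \<in> ?E" for e
  proof -
    from that consider "e = {a, j}" | "e \<in> E1" | "e \<in> E2" by blast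
    then show ?thesis
      by cases (use a j is_tree_edge(1)[OF t1, of e] is_tree_edge(1)[OF t2, of e] in blast)+
  qed
  show "card e = 2" if "e \<in> ?E" for e
  proof -
    from that consider "e = {a, j}" | "e \<in> E1" | "e \<in> E2" by blast
    then show ?thesis
      by cases (simp_all add: \<open>a \<noteq> j\<close> is_tree_edge(2)[OF t1, of e] is_tree_edge(2)[OF t2, of e])
  qed
  have "(x, j) \<in> (adj ?E)\<^sup>*" if "x \<in> V1 \<union> V2" for x
  proof (cases "x \<in> V1")
    case True
    show ?thesis by (rule reach_mono[OF is_tree_reach[OF t1 True j]]) blast
  next
    case False
    with that have "x \<in> V2" by simp
    have "(x, a) \<in> (adj ?E)\<^sup>*"
      by (rule reach_mono[OF is_tree_reach[OF t2 \<open>x \<in> V2\<close> a]]) blast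
    moreover have "(a, j) \<in> adj ?E" by simp
    ultimately show ?thesis by (rule rtrancl.rtrancl_into_rtrancl)
  qed
  then show "(x, y) \<in> (adj ?E)\<^sup>*" if "x \<in> V1 \<union> V2" "y \<in> V1 \<union> V2" for x y
    using that reach_sym rtrancl_trans by meson
  have cross: "(a, j) \<notin> (adj (?E - {{a, j}}))\<^sup>*"
  proof
    assume "(a, j) \<in> (adj (?E - {{a, j}}))\<^sup>*"
    then have "j \<in> V2" using a
      by (rule reach_closed)
        (use is_tree_edge(1)[OF t1] is_tree_edge(1)[OF t2] disj in blast)
    with j disj show False by blast
  qed
  show "all_bridges ?E"
    unfolding all_bridges_def
  proof (intro allI impI)
    fix x y assume "{x, y} \<in> ?E"
    then consider "x = a" "y = j" | "x = j" "y = a" | "{x, y} \<in> E1" | "{x, y} \<in> E2"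
      by (auto simp: doubleton_eq_iff)
    then show "(x, y) \<notin> (adj (?E - {{x, y}}))\<^sup>*"
    proof cases
      case 1
      with cross show ?thesis by simp
    next
      case 2
      with cross reach_sym show ?thesis by (metis insert_commute)
    next
      case 3
      with join_bridge[OF t1 t2 disj j a] show ?thesis by simp
    next
      case 4
      with join_bridge[OF t2 t1 _ a j, of x y] disj show ?thesis
        by (simp add: Int_commute Un_commute insert_commute)
    qed
  qed
qed

section \<open>Cutting a tree at the branch of \<open>b\<close> seen from \<open>a\<close>\<close>

definition branch :: "nat set set \<Rightarrow> nat \<Rightarrow> nat \<Rightarrow> nat set" where
  "branch E a b = {v. (b, v) \<in> (adj {e\<in>E. a \<notin> e})\<^sup>*}"

lemma branch_step:
  "x \<in> branch E a b \<Longrightarrow> {x, y} \<in> E \<Longrightarrow> x \<noteq> a \<Longrightarrow> y \<noteq> a \<Longrightarrow> y \<in> branch E a b"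
  unfolding branch_def by (auto intro: rtrancl.rtrancl_into_rtrancl)

text \<open>\<open>branch E a b\<close> is the component of \<open>b\<close> once all edges at
  \<open>a\<close> are removed. In a tree it is also the side of \<open>b\<close> when only the
  first edge \<open>{a, j}\<close> of the path from \<open>a\<close> to \<open>b\<close> is cut, so
  the cut is described before \<open>j\<close> is known.\<close>

lemma is_tree_split:
  assumes t: "is_tree V E" and ab: "a \<in> V" "b \<in> V" "a \<noteq> b"
  defines "T \<equiv> branch E a b"
  obtains j where "b \<in> T" "a \<notin> T" "T \<subseteq> V" "j \<in> T"
    "is_tree T {e\<in>E. e \<subseteq> T}" "is_tree (V - T) {e\<in>E. e \<subseteq> V - T}"
    "E = insert {a, j} ({e\<in>E. e \<subseteq> T} \<union> {e\<in>E. e \<subseteq> V - T})"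
proof -
  have bT: "b \<in> T" by (simp add: T_def branch_def)
  have aT: "a \<notin> T"
  proof
    assume "a \<in> T"
    then have "(b, a) \<in> (adj {e\<in>E. a \<notin> e})\<^sup>*" by (simp add: T_def branch_def)
    then have "a \<in> - {a}" by (rule reach_closed) (use ab in auto)
    then show False by simp
  qed
  have TV: "T \<subseteq> V"
  proof
    fix v assume "v \<in> T"
    then have "(b, v) \<in> (adj {e\<in>E. a \<notin> e})\<^sup>*" by (simp add: T_def branch_def)
    then show "v \<in> V" using ab(2) by (rule reach_closed) (use is_tree_edge(1)[OF t] in blast)
  qed
  have step: "y \<in> T" if "x \<in> T" "{x, y} \<in> E" "y \<noteq> a" for x y
    using that aT branch_step[of x E a b y] unfolding T_def by metis
  \<comment> \<open>Without such an edge \<open>T\<close> would be closed under all of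
    \<open>E\<close>, and connectedness would put \<open>a\<close> into \<open>T\<close>.\<close>
  have "\<exists>j\<in>T. {a, j} \<in> E"
  proof (rule ccontr)
    assume no: "\<not> (\<exists>j\<in>T. {a, j} \<in> E)"
    from is_tree_reach[OF t ab(2,1)] have "a \<in> T" using bT
      by (rule reach_closed) (use no step in \<open>metis insert_commute\<close>)
    with aT show False by simp
  qed
  then obtain j where j: "j \<in> T" "{a, j} \<in> E" by blast
  have inT: "(u, v) \<in> (adj {e\<in>E. e \<subseteq> T})\<^sup>*" if "u \<in> T" "v \<in> T" for u v
  proof -
    have "(b, v) \<in> (adj {e\<in>E. e \<subseteq> T})\<^sup>*" if "v \<in> T" for v
    proof -
      from that have "(b, v) \<in> (adj {e\<in>E. a \<notin> e})\<^sup>*" by (simp add: T_def branch_def)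
      then have "v \<in> T \<and> (b, v) \<in> (adj {e\<in>E. e \<subseteq> T})\<^sup>*"
      proof (induction rule: rtrancl_induct)
        case (step u v)
        from step.hyps(2) have "{u, v} \<in> E" "v \<noteq> a" by auto
        with step.IH \<open>\<And>x y. x \<in> T \<Longrightarrow> {x, y} \<in> E \<Longrightarrow> y \<noteq> a \<Longrightarrow> y \<in> T\<close> have "v \<in> T" by blast
        with step.IH \<open>{u, v} \<in> E\<close> show ?case
          by (auto intro!: rtrancl.rtrancl_into_rtrancl[of b u])
      qed (use bT in simp)
      then show ?thesis by blast
    qed
    with that show ?thesis by (meson reach_sym rtrancl_trans)
  qed
  \<comment> \<open>A second edge from \<open>a\<close> into \<open>T\<close>, continued inside
    \<open>T\<close> to \<open>j\<close>, would bypass the bridge \<open>{a, j}\<close>.\<close>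
  have uniq: "x = j" if "x \<in> T" "{a, x} \<in> E" for x
  proof (rule ccontr)
    assume "x \<noteq> j"
    then have "(a, x) \<in> adj (E - {{a, j}})" using that by (auto simp: doubleton_eq_iff)
    moreover have "(x, j) \<in> (adj (E - {{a, j}}))\<^sup>*"
      by (rule reach_mono[OF inT[OF that(1) j(1)]]) (use aT in auto)
    ultimately have "(a, j) \<in> (adj (E - {{a, j}}))\<^sup>*" by (rule converse_rtrancl_into_rtrancl)
    with all_bridgesD[OF is_tree_bridges[OF t] j(2)] show False by blast
  qed
  have cross: "x = j \<and> y = a" if "x \<in> T" "y \<notin> T" "{x, y} \<in> E" for x y
    using that step uniq by (metis insert_commute)
  have conn2: "(a, v) \<in> (adj {e\<in>E. e \<subseteq> V - T})\<^sup>*" if "v \<in> V - T" for v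
  proof -
    from that is_tree_reach[OF t ab(1)] have "(a, v) \<in> (adj E)\<^sup>*" by blast
    \<comment> \<open>A walk from \<open>a\<close> may pass through \<open>T\<close>, hence the
      disjunction: it can leave \<open>T\<close> only by the edge from \<open>j\<close> to
      \<open>a\<close>, and at \<open>a\<close> the reachability claim holds trivially
      again.\<close>
    then have "v \<in> T \<or> (a, v) \<in> (adj {e\<in>E. e \<subseteq> V - T})\<^sup>*"
    proof (induction rule: rtrancl_induct)
      case (step u v)
      have uv: "{u, v} \<in> E" using step.hyps by simp
      show ?case
      proof (cases "v \<in> T \<or> u \<in> T")
        case True
        with cross[of u v] uv show ?thesis by auto
      next
        case False
        with uv is_tree_edge(1)[OF t uv] have "(u, v) \<in> adj {e\<in>E. e \<subseteq> V - T}" by auto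
        with False step.IH show ?thesis by (meson rtrancl.rtrancl_into_rtrancl)
      qed
    qed simp
    with that show ?thesis by blast
  qed
  show thesis
  proof (rule that[OF bT aT TV j(1)])
    show "is_tree T {e\<in>E. e \<subseteq> T}"
      unfolding is_tree_iff
      using bT inT is_tree_edge(2)[OF t] all_bridges_mono[OF is_tree_bridges[OF t]] by auto
    have "(u, v) \<in> (adj {e\<in>E. e \<subseteq> V - T})\<^sup>*" if "u \<in> V - T" "v \<in> V - T" for u v
      using that conn2 by (meson reach_sym rtrancl_trans)
    then show "is_tree (V - T) {e\<in>E. e \<subseteq> V - T}"
      unfolding is_tree_iff
      using ab aT is_tree_edge(2)[OF t] all_bridges_mono[OF is_tree_bridges[OF t]] by auto
    show "E = insert {a, j} ({e\<in>E. e \<subseteq> T} \<union> {e\<in>E. e \<subseteq> V - T})"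
    proof (intro equalityI subsetI)
      fix e assume e: "e \<in> E"
      with is_tree_edge(2)[OF t e] obtain x y where xy: "e = {x, y}" by (auto simp: card_2_iff)
      with is_tree_edge(1)[OF t e] e cross[of x y] cross[of y x]
      show "e \<in> insert {a, j} ({e\<in>E. e \<subseteq> T} \<union> {e\<in>E. e \<subseteq> V - T})"
        by (auto simp: insert_commute)
    qed (use j in auto)
  qed
qed

text \<open>A walk from \<open>b\<close> avoiding \<open>a\<close> cannot use \<open>{a, j}\<close>
  and so never leaves \<open>T\<close>, while the edges of \<open>E1\<close> avoid \<open>a\<close>
  and connect \<open>T\<close>.\<close>

lemma branch_join:
  assumes t1: "is_tree T E1" and t2: "is_tree V2 E2" and disj: "T \<inter> V2 = {}"
    and a: "a \<in> V2" and b: "b \<in> T"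
  shows "branch (insert {a, j} (E1 \<union> E2)) a b = T"
proof
  let ?E = "{e \<in> insert {a, j} (E1 \<union> E2). a \<notin> e}"
  show "branch (insert {a, j} (E1 \<union> E2)) a b \<subseteq> T"
  proof
    fix v assume "v \<in> branch (insert {a, j} (E1 \<union> E2)) a b"
    then have "(b, v) \<in> (adj ?E)\<^sup>*" by (simp add: branch_def)
    then show "v \<in> T" using b
      by (rule reach_closed)
        (use is_tree_edge(1)[OF t1] is_tree_edge(1)[OF t2] disj in blast)
  qed
  have "E1 \<subseteq> ?E" using is_tree_edge(1)[OF t1] a disj by blast
  then show "T \<subseteq> branch (insert {a, j} (E1 \<union> E2)) a b"
    using is_tree_reach[OF t1 b] reach_mono unfolding branch_def by blast
qed

section \<open>Weighted tree sums\<close>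

text \<open>For finite \<open>V\<close> this is the spanning tree polynomial of the complete graph
  on \<open>V\<close>. It vanishes at the empty set, since trees are nonempty; splittings with an
  empty part thus contribute nothing to the sums over \<open>Pow V\<close>.\<close>

definition tree_sum :: "(nat set \<Rightarrow> 'a::comm_ring_1) \<Rightarrow> nat set \<Rightarrow> 'a" where
  "tree_sum w V = (\<Sum>E | is_tree V E. \<Prod>e\<in>E. w e)"

lemma finite_trees: "finite V \<Longrightarrow> finite {E. is_tree V E}"
  by (rule finite_subset[of _ "Pow (Pow V)"]) (auto dest: is_tree_edge(1))

lemma is_tree_finite_edges: "is_tree V E \<Longrightarrow> finite V \<Longrightarrow> finite E"
  by (rule finite_subset[of _ "Pow V"]) (auto dest: is_tree_edge(1))

lemma is_tree_singleton: "is_tree {v} E \<longleftrightarrow> E = {}"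
proof
  assume t: "is_tree {v} E"
  have False if "e \<in> E" for e
    using is_tree_edge[OF t that] card_mono[of "{v}" e] by simp
  then show "E = {}" by blast
qed (simp add: is_tree_iff all_bridges_def)

lemma tree_sum_singleton [simp]: "tree_sum w {v} = 1"
  by (simp add: tree_sum_def is_tree_singleton)

text \<open>The branch, the attaching vertex and both edge sets can be read off from the joined
  tree, so joining is injective; the last two facts make the product over the edges factor.\<close>

lemma joined_tree_parts:
  assumes "is_tree T E1" "is_tree V2 E2" "T \<inter> V2 = {}" "a \<in> V2" "b \<in> T" "j \<in> T"
  defines "E \<equiv> insert {a, j} (E1 \<union> E2)"
  shows "branch E a b = T" "{x \<in> T. {a, x} \<in> E} = {j}"
    "{e \<in> E. e \<subseteq> T} = E1" "{e \<in> E. e \<subseteq> V2} = E2"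
    "E1 \<inter> E2 = {}" "{a, j} \<notin> E1 \<union> E2"
proof -
  note e1 = is_tree_edge[OF assms(1)] and e2 = is_tree_edge[OF assms(2)]
  have ne: "e \<noteq> {}" if "e \<in> E1 \<union> E2" for e using that e1(2)[of e] e2(2)[of e] by auto
  show "branch E a b = T" unfolding E_def by (rule branch_join[OF assms(1-5)])
  show "{x \<in> T. {a, x} \<in> E} = {j}"
  proof (intro equalityI subsetI)
    fix x assume x: "x \<in> {x \<in> T. {a, x} \<in> E}"
    with e1(1)[of "{a, x}"] e2(1)[of "{a, x}"] assms(3-6) have "{a, x} = {a, j}"
      unfolding E_def by blast
    then show "x \<in> {j}" by (auto simp: doubleton_eq_iff)
  qed (use assms in simp)
  show "{e \<in> E. e \<subseteq> T} = E1" "{e \<in> E. e \<subseteq> V2} = E2" "E1 \<inter> E2 = {}" "{a, j} \<notin> E1 \<union> E2"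
    using e1(1) e2(1) ne assms(3-6) unfolding E_def by blast+
qed

text \<open>Joining and cutting are inverse bijections between the tuples
  \<open>(T, j, E1, E2)\<close> and the trees on \<open>V\<close>: \<open>T\<close> is the branch
  containing \<open>b\<close>, and \<open>j\<close> the vertex by which it hangs on
  \<open>a\<close>.\<close>

lemma tree_sum_cut:
  fixes w :: "nat set \<Rightarrow> 'a::comm_ring_1"
  assumes V: "finite V" and ab: "a \<in> V" "b \<in> V" "a \<noteq> b"
  shows "(\<Sum>T | T \<subseteq> V \<and> b \<in> T \<and> a \<notin> T. tree_sum w T * tree_sum w (V - T) * (\<Sum>j\<in>T. w {a, j}))
    = tree_sum w V"
proof -
  define C where "C = {T. T \<subseteq> V \<and> b \<in> T \<and> a \<notin> T}"
  define tr where "tr U = {E. is_tree U E}" for U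
  define I where "I = (SIGMA T:C. T \<times> tr T \<times> tr (V - T))"
  define f where "f = (\<lambda>(T :: nat set, j, E1, E2). insert {a, j} (E1 \<union> E2))"
  \<comment> \<open>On a tree, \<open>a\<close> has exactly one neighbour in the branch, so
    \<open>the_elem\<close> returns \<open>j\<close>.\<close>
  define g where "g E = (branch E a b, the_elem {x \<in> branch E a b. {a, x} \<in> E},
    {e \<in> E. e \<subseteq> branch E a b}, {e \<in> E. e \<subseteq> V - branch E a b})" for E
  have fin: "finite T" "finite (tr T)" "finite (tr (V - T))" if "T \<in> C" for T
    using that V finite_subset by (auto simp: C_def tr_def intro!: finite_trees)
  have parts: "f (T, j, E1, E2) \<in> tr V" "g (f (T, j, E1, E2)) = (T, j, E1, E2)"
    "(\<Prod>e\<in>f (T, j, E1, E2). w e) = (\<Prod>e\<in>E1. w e) * (\<Prod>e\<in>E2. w e) * w {a, j}"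
    if "(T, j, E1, E2) \<in> I" for T j E1 E2
  proof -
    from that ab have T: "T \<subseteq> V" "b \<in> T" "a \<notin> T" "j \<in> T"
      and t1: "is_tree T E1" and t2: "is_tree (V - T) E2" and a: "a \<in> V - T"
      by (auto simp: I_def C_def tr_def)
    have disj: "T \<inter> (V - T) = {}" by blast
    note p = joined_tree_parts[OF t1 t2 disj a T(2,4)]
    have "T \<union> (V - T) = V" using T by blast
    with is_tree_join[OF t1 t2 disj T(4) a] show "f (T, j, E1, E2) \<in> tr V"
      by (simp add: f_def tr_def)
    show "g (f (T, j, E1, E2)) = (T, j, E1, E2)"
      unfolding g_def f_def prod.case p(1) p(2) p(3) p(4) by simp
    have "finite E1" "finite E2"
      using is_tree_finite_edges[OF t1] is_tree_finite_edges[OF t2] V T finite_subset by auto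
    then show "(\<Prod>e\<in>f (T, j, E1, E2). w e) = (\<Prod>e\<in>E1. w e) * (\<Prod>e\<in>E2. w e) * w {a, j}"
      unfolding f_def prod.case using p(5,6) by (simp add: prod.union_disjoint mult_ac)
  qed
  have split: "g E \<in> I \<and> f (g E) = E" if E: "E \<in> tr V" for E
  proof -
    define T where "T = branch E a b"
    from E have "is_tree V E" by (simp add: tr_def)
    from is_tree_split[OF this ab] obtain j where T: "b \<in> T" "a \<notin> T" "T \<subseteq> V" "j \<in> T"
      and t1: "is_tree T {e\<in>E. e \<subseteq> T}" and t2: "is_tree (V - T) {e\<in>E. e \<subseteq> V - T}"
      and E_eq: "E = insert {a, j} ({e\<in>E. e \<subseteq> T} \<union> {e\<in>E. e \<subseteq> V - T})"
      unfolding T_def by blast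
    have a: "a \<in> V - T" and disj: "T \<inter> (V - T) = {}" using ab T by auto
    from joined_tree_parts(2)[OF t1 t2 disj a T(1,4)] have "{x \<in> T. {a, x} \<in> E} = {j}"
      using E_eq by simp
    then have g: "g E = (T, j, {e\<in>E. e \<subseteq> T}, {e\<in>E. e \<subseteq> V - T})"
      unfolding g_def T_def[symmetric] by simp
    show ?thesis
      unfolding g using T t1 t2 E_eq[symmetric] by (simp add: I_def C_def tr_def f_def)
  qed
  have "(\<Sum>T\<in>C. tree_sum w T * tree_sum w (V - T) * (\<Sum>j\<in>T. w {a, j}))
      = (\<Sum>T\<in>C. \<Sum>(j, E1, E2)\<in>T \<times> tr T \<times> tr (V - T).
          (\<Prod>e\<in>E1. w e) * (\<Prod>e\<in>E2. w e) * w {a, j})"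
  proof (rule sum.cong[OF refl])
    fix T
    have "tree_sum w T * tree_sum w (V - T) * (\<Sum>j\<in>T. w {a, j})
       = (\<Sum>j\<in>T. \<Sum>E1\<in>tr T. \<Sum>E2\<in>tr (V - T). (\<Prod>e\<in>E1. w e) * (\<Prod>e\<in>E2. w e) * w {a, j})"
      unfolding tree_sum_def tr_def[symmetric]
      by (simp add: sum_product sum_distrib_left sum_distrib_right)
        (rule sum.cong[OF refl], rule sum.swap)
    then show "tree_sum w T * tree_sum w (V - T) * (\<Sum>j\<in>T. w {a, j})
       = (\<Sum>(j, E1, E2)\<in>T \<times> tr T \<times> tr (V - T). (\<Prod>e\<in>E1. w e) * (\<Prod>e\<in>E2. w e) * w {a, j})"
      by (simp add: sum.cartesian_product)
  qed
  also have "\<dots> = (\<Sum>(T, j, E1, E2)\<in>I. (\<Prod>e\<in>E1. w e) * (\<Prod>e\<in>E2. w e) * w {a, j})"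
    unfolding I_def by (rule sum.Sigma) (use V fin in \<open>auto simp: C_def\<close>)
  also have "\<dots> = (\<Sum>E\<in>tr V. \<Prod>e\<in>E. w e)"
    by (rule sum.reindex_bij_witness[where i = g and j = f]) (use parts split in auto)
  finally show ?thesis by (simp add: C_def tr_def tree_sum_def)
qed

section \<open>The quadratic identity for tree sums\<close>

lemma sum_antisym_pairs:
  fixes w :: "nat set \<Rightarrow> 'a::comm_ring_1"
  shows "(\<Sum>i\<in>T. \<Sum>j\<in>T. w {i, j} * (z i - z j)) = 0"
proof -
  \<comment> \<open>Two equal halves are subtracted; concluding from the sum being its own negative
    would fail in characteristic 2.\<close>
  have "(\<Sum>i\<in>T. \<Sum>j\<in>T. w {i, j} * z j) = (\<Sum>i\<in>T. \<Sum>j\<in>T. w {i, j} * z i)"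
    by (subst sum.swap) (simp add: insert_commute)
  then show ?thesis by (simp add: right_diff_distrib sum_subtractf)
qed

text \<open>Let L be the weighted Laplacian and 1_T the indicator of \<open>T\<close>. Then
  \<open>g\<close> is L z and \<open>r a T\<close> is (L 1_T)(a), so \<open>h T\<close> is the sum
  of \<open>g b\<close> over \<open>b\<close> in \<open>T\<close> and also the sum of
  \<open>z a * r a T\<close> over \<open>V\<close>. Using one form for each factor of the square
  leaves sums that \<open>tree_sum_cut\<close> evaluates.\<close>

lemma tree_sum_cut_square:
  fixes w :: "nat set \<Rightarrow> 'a::comm_ring_1"
  assumes V: "finite V"
  shows "(\<Sum>T\<in>Pow V. tree_sum w T * tree_sum w (V - T)
        * (\<Sum>i\<in>T. \<Sum>j\<in>V - T. w {i, j} * (z i - z j))\<^sup>2)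
    = tree_sum w V * (\<Sum>i\<in>V. \<Sum>j\<in>V. w {i, j} * (z i - z j)\<^sup>2)"
proof -
  define c where "c T = tree_sum w T * tree_sum w (V - T)" for T
  define h where "h T = (\<Sum>i\<in>T. \<Sum>j\<in>V - T. w {i, j} * (z i - z j))" for T
  define s where "s a T = (\<Sum>j\<in>T. w {a, j})" for a T
  define g where "g b = (\<Sum>j\<in>V. w {b, j} * (z b - z j))" for b
  define r where "r a T = (if a \<in> T then s a (V - T) else - s a T)" for a T
  define D where "D a = (\<Sum>T | T \<in> Pow V \<and> a \<in> T. c T * s a (V - T))" for a
  define A where "A = tree_sum w V"
  \<comment> \<open>The part that does not depend on \<open>b\<close>; it ends up multiplied by the
    sum of all \<open>g b\<close>, which is zero.\<close>
  define K where "K = (\<Sum>a\<in>V. z a * (D a - 2 * A))"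
  have h_g: "h T = (\<Sum>b | b \<in> V \<and> b \<in> T. g b)" if T: "T \<subseteq> V" for T
  proof -
    have "g i = (\<Sum>j\<in>V - T. w {i, j} * (z i - z j)) + (\<Sum>j\<in>T. w {i, j} * (z i - z j))" for i
      unfolding g_def by (rule sum.subset_diff[OF T V])
    moreover have "{b. b \<in> V \<and> b \<in> T} = T" using T by blast
    ultimately show ?thesis by (simp add: h_def sum.distrib sum_antisym_pairs)
  qed
  have h_z: "h T = (\<Sum>a\<in>V. z a * r a T)" if T: "T \<subseteq> V" for T
  proof -
    have "(\<Sum>a\<in>V. z a * r a T) = (\<Sum>a\<in>V - T. z a * r a T) + (\<Sum>a\<in>T. z a * r a T)"
      by (rule sum.subset_diff[OF T V])
    also have "(\<Sum>a\<in>V - T. z a * r a T) = - (\<Sum>i\<in>T. \<Sum>j\<in>V - T. w {i, j} * z j)"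
      by (subst sum.swap)
        (simp add: r_def s_def sum_distrib_left sum_negf insert_commute mult.commute)
    also have "(\<Sum>a\<in>T. z a * r a T) = (\<Sum>i\<in>T. \<Sum>j\<in>V - T. w {i, j} * z i)"
      by (simp add: r_def s_def sum_distrib_left mult.commute)
    finally show ?thesis by (simp add: h_def right_diff_distrib sum_subtractf)
  qed
  have cut: "(\<Sum>T | T \<in> Pow V \<and> b \<in> T \<and> a \<notin> T. c T * s a T) = A"
    if "a \<in> V" "b \<in> V" "a \<noteq> b" for a b
    using tree_sum_cut[OF V that, of w] by (simp add: c_def s_def A_def)
  \<comment> \<open>Inversion of the Laplacian up to terms constant in \<open>b\<close>. Off the
    diagonal, let \<open>B\<close> be the contribution of the sets containing both points: passing
    to complements gives \<open>D a = B + A\<close>, and the left side is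
    \<open>B - A\<close>.\<close>
  have Y: "(\<Sum>T | T \<in> Pow V \<and> b \<in> T. c T * r a T) = D a - 2 * A + (if a = b then 2 * A else 0)"
    if a: "a \<in> V" and b: "b \<in> V" for a b
  proof (cases "a = b")
    case True
    then show ?thesis by (simp add: D_def r_def)
  next
    case False
    define B where "B = (\<Sum>T | T \<in> Pow V \<and> a \<in> T \<and> b \<in> T. c T * s a (V - T))"
    have "D a = B + (\<Sum>T | T \<in> Pow V \<and> a \<in> T \<and> b \<notin> T. c T * s a (V - T))"
      unfolding D_def B_def
      by (subst sum.union_disjoint[symmetric]) (use V in \<open>auto intro!: sum.cong\<close>)
    also have "(\<Sum>T | T \<in> Pow V \<and> a \<in> T \<and> b \<notin> T. c T * s a (V - T))
        = (\<Sum>T | T \<in> Pow V \<and> b \<in> T \<and> a \<notin> T. c T * s a T)"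
      by (rule sum.reindex_bij_witness[where i = "\<lambda>T. V - T" and j = "\<lambda>T. V - T"])
        (use a b in \<open>auto simp: c_def double_diff mult.commute\<close>)
    also have "\<dots> = A" using a b False by (rule cut)
    finally have D: "D a = B + A" .
    have "(\<Sum>T | T \<in> Pow V \<and> b \<in> T. c T * r a T)
        = B + (\<Sum>T | T \<in> Pow V \<and> b \<in> T \<and> a \<notin> T. c T * r a T)"
    proof -
      have "B = (\<Sum>T | T \<in> Pow V \<and> a \<in> T \<and> b \<in> T. c T * r a T)"
        unfolding B_def by (rule sum.cong) (auto simp: r_def)
      then show ?thesis
        by (simp only:) (subst sum.union_disjoint[symmetric]; use V in \<open>auto intro!: sum.cong\<close>)
    qed
    also have "(\<Sum>T | T \<in> Pow V \<and> b \<in> T \<and> a \<notin> T. c T * r a T)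
        = - (\<Sum>T | T \<in> Pow V \<and> b \<in> T \<and> a \<notin> T. c T * s a T)"
      unfolding sum_negf[symmetric] by (rule sum.cong) (auto simp: r_def)
    also have "\<dots> = - A" using cut[OF a b False] by simp
    finally show ?thesis using D False by simp
  qed
  \<comment> \<open>One factor \<open>h T\<close> is expanded in \<open>g\<close> and the sums over
    \<open>T\<close> and \<open>b\<close> are exchanged; the other factor is expanded by
    \<open>h_z\<close> afterwards.\<close>
  have "(\<Sum>T\<in>Pow V. c T * (h T)\<^sup>2) = (\<Sum>T\<in>Pow V. \<Sum>b | b \<in> V \<and> b \<in> T. g b * (c T * h T))"
  proof (rule sum.cong[OF refl])
    fix T assume "T \<in> Pow V"
    then have "c T * (h T)\<^sup>2 = (\<Sum>b | b \<in> V \<and> b \<in> T. g b) * (c T * h T)"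
      using h_g by (simp add: power2_eq_square mult_ac)
    then show "c T * (h T)\<^sup>2 = (\<Sum>b | b \<in> V \<and> b \<in> T. g b * (c T * h T))"
      by (simp add: sum_distrib_right)
  qed
  also have "\<dots> = (\<Sum>b\<in>V. \<Sum>T | T \<in> Pow V \<and> b \<in> T. g b * (c T * h T))"
    by (rule sum.swap_restrict) (use V in auto)
  also have "\<dots> = (\<Sum>b\<in>V. g b * (K + 2 * A * z b))"
  proof (rule sum.cong[OF refl])
    fix b assume b: "b \<in> V"
    have "(\<Sum>T | T \<in> Pow V \<and> b \<in> T. c T * h T)
        = (\<Sum>T | T \<in> Pow V \<and> b \<in> T. \<Sum>a\<in>V. z a * (c T * r a T))"
      by (rule sum.cong) (auto simp: h_z sum_distrib_left mult_ac)
    also have "\<dots> = (\<Sum>a\<in>V. z a * (\<Sum>T | T \<in> Pow V \<and> b \<in> T. c T * r a T))"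
      by (subst sum.swap) (simp add: sum_distrib_left)
    also have "\<dots> = (\<Sum>a\<in>V. z a * (D a - 2 * A) + (if a = b then 2 * A * z b else 0))"
      by (rule sum.cong[OF refl], subst Y[OF _ b]) (auto simp: algebra_simps)
    also have "\<dots> = K + 2 * A * z b" using V b by (simp add: sum.distrib K_def)
    finally show "(\<Sum>T | T \<in> Pow V \<and> b \<in> T. g b * (c T * h T)) = g b * (K + 2 * A * z b)"
      by (simp add: sum_distrib_left[symmetric])
  qed
  also have "\<dots> = (\<Sum>b\<in>V. g b) * K + 2 * A * (\<Sum>b\<in>V. g b * z b)"
    by (simp add: distrib_left sum.distrib sum_distrib_left sum_distrib_right mult_ac)
  also have "(\<Sum>b\<in>V. g b) = 0" unfolding g_def by (rule sum_antisym_pairs)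
  finally have main: "(\<Sum>T\<in>Pow V. c T * (h T)\<^sup>2) = 2 * A * (\<Sum>b\<in>V. g b * z b)" by simp
  \<comment> \<open>Here (z_i - z_j)^2 = (z_i - z_j) z_i + (z_j - z_i) z_j, and the two halves agree
    after exchanging the indices.\<close>
  have "(\<Sum>i\<in>V. \<Sum>j\<in>V. w {i, j} * (z i - z j)\<^sup>2)
      = (\<Sum>i\<in>V. g i * z i) + (\<Sum>i\<in>V. \<Sum>j\<in>V. w {i, j} * (z j - z i) * z j)"
    unfolding g_def sum_distrib_right sum.distrib[symmetric]
    by (intro sum.cong refl) (simp add: power2_eq_square algebra_simps)
  also have "(\<Sum>i\<in>V. \<Sum>j\<in>V. w {i, j} * (z j - z i) * z j) = (\<Sum>i\<in>V. g i * z i)"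
    by (subst sum.swap) (simp add: g_def sum_distrib_right insert_commute)
  finally have "A * (\<Sum>i\<in>V. \<Sum>j\<in>V. w {i, j} * (z i - z j)\<^sup>2) = 2 * A * (\<Sum>b\<in>V. g b * z b)"
    by (simp only: mult_2 distrib_left distrib_right)
  with main show ?thesis by (simp only: c_def h_def A_def)
qed

section \<open>Sums of plane waves\<close>

text \<open>Each monomial carries the product of its plane waves with a free amplitude
  \<open>c S\<close>. Derivatives multiply \<open>c\<close> by momenta and products convolve over
  subsets, so the field equation becomes a numerical identity for each \<open>S\<close>.\<close>

lift_definition wave_sum ::
  "(nat \<Rightarrow> complex) \<Rightarrow> (nat \<Rightarrow> complex) \<Rightarrow> (nat \<Rightarrow> complex) \<Rightarrow> (nat set \<Rightarrow> complex) \<Rightarrow> field_fun"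
  is "\<lambda>\<omega> z zb c X S. if finite S then c S * exp (\<Sum>k\<in>S. \<i> * mom_dot \<omega> z zb k X) else 0"
  by simp

definition mom ::
  "(nat \<Rightarrow> complex) \<Rightarrow> (nat \<Rightarrow> complex) \<Rightarrow> (nat \<Rightarrow> complex) \<Rightarrow> coord \<Rightarrow> nat set \<Rightarrow> complex" where
  "mom \<omega> z zb m S = (\<Sum>k\<in>S. mom_comp (\<omega> k) (z k) (zb k) m)"

lemma coeff_wave_sum_deriv:
  "((\<lambda>t. coeff (wave_sum \<omega> z zb c (X(m := t))) S) has_field_derivative
     coeff (wave_sum \<omega> z zb (\<lambda>S. \<i> * mom \<omega> z zb m S * c S) X) S) (at (X m))"
proof -
  have "((\<lambda>t. mom_dot \<omega> z zb k (X(m := t))) has_field_derivative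
      mom_comp (\<omega> k) (z k) (zb k) m) (at (X m))" for k
    unfolding mom_dot_def by (cases m) (auto intro!: derivative_eq_intros)
  then have "((\<lambda>t. c S * exp (\<Sum>k\<in>S. \<i> * mom_dot \<omega> z zb k (X(m := t)))) has_field_derivative
      \<i> * mom \<omega> z zb m S * c S * exp (\<Sum>k\<in>S. \<i> * mom_dot \<omega> z zb k X)) (at (X m))"
    by (auto intro!: derivative_eq_intros simp: mom_def sum_distrib_left sum_distrib_right mult_ac)
  then show ?thesis by (simp add: wave_sum.rep_eq)
qed

lemma pd_wave_sum:
  "pd m (wave_sum \<omega> z zb c) = wave_sum \<omega> z zb (\<lambda>S. \<i> * mom \<omega> z zb m S * c S)"
  by (intro ext epsalg_eqI) (simp add: pd_def derivE.rep_eq DERIV_imp_deriv[OF coeff_wave_sum_deriv])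

text \<open>Iterated derivatives are again wave sums, so first-order differentiability of every wave
  sum suffices.\<close>

lemma smooth_wave_sum: "smooth_field (wave_sum \<omega> z zb c)"
proof -
  have "\<exists>c'. foldr pd ms (wave_sum \<omega> z zb c) = wave_sum \<omega> z zb c'" for ms
    by (induction ms) (auto simp: pd_wave_sum)
  then show ?thesis
    unfolding smooth_field_def field_differentiable_def by (metis coeff_wave_sum_deriv)
qed

lemma wave_sum_diff:
  "wave_sum \<omega> z zb c X - wave_sum \<omega> z zb d X = wave_sum \<omega> z zb (\<lambda>S. c S - d S) X"
  by (rule epsalg_eqI) (simp add: wave_sum.rep_eq minus_epsalg.rep_eq left_diff_distrib)

lemma wave_sum_mult:
  "wave_sum \<omega> z zb c X * wave_sum \<omega> z zb d X
     = wave_sum \<omega> z zb (\<lambda>S. \<Sum>T\<in>Pow S. c T * d (S - T)) X"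
proof (rule epsalg_eqI)
  fix S :: "nat set" assume S: "finite S"
  let ?e = "\<lambda>S. exp (\<Sum>k\<in>S. \<i> * mom_dot \<omega> z zb k X)"
  have "?e S = ?e T * ?e (S - T)" if "T \<subseteq> S" for T
    using sum.subset_diff[OF that S] by (metis exp_add mult.commute)
  then show "coeff (wave_sum \<omega> z zb c X * wave_sum \<omega> z zb d X) S
    = coeff (wave_sum \<omega> z zb (\<lambda>S. \<Sum>T\<in>Pow S. c T * d (S - T)) X) S"
    using S finite_subset[OF _ S]
    by (auto simp: wave_sum.rep_eq times_epsalg.rep_eq sum_distrib_right intro!: sum.cong)
qed

lemma wave_op_wave_sum:
  "wave_op (wave_sum \<omega> z zb c) X
     = wave_sum \<omega> z zb (\<lambda>S. c S * (mom \<omega> z zb CW S * mom \<omega> z zb CWbar S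
         - mom \<omega> z zb CU S * mom \<omega> z zb CUbar S)) X"
proof -
  have "\<i> * x * (\<i> * y * e) - \<i> * u * (\<i> * v * e) = e * (u * v - x * y)" for x y u v e
    by (simp add: algebra_simps)
  then show ?thesis
    by (simp only: wave_op_def pd_wave_sum wave_sum_diff)
qed

text \<open>Each term carries four derivatives, whose factors of the imaginary unit multiply to 1,
  against -1 in \<open>wave_op_wave_sum\<close>.\<close>

lemma poisson_wave_sum:
  fixes \<omega> z zb :: "nat \<Rightarrow> complex"
  defines "p \<equiv> mom \<omega> z zb"
  shows "poisson (pd CU (wave_sum \<omega> z zb c)) (pd CW (wave_sum \<omega> z zb c)) X
    = wave_sum \<omega> z zb (\<lambda>S. \<Sum>T\<in>Pow S. c T * c (S - T) * ((p CU T * p CW (S - T))\<^sup>2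
        - p CU T * p CW T * p CU (S - T) * p CW (S - T))) X"
proof -
  have "\<i> * x * (\<i> * x * d) * (\<i> * v * (\<i> * v * e)) - \<i> * y * (\<i> * x * d) * (\<i> * u * (\<i> * v * e))
      = d * e * ((x * v)\<^sup>2 - x * y * u * v)" for x y u v d e
    by (simp add: algebra_simps power2_eq_square)
  then show ?thesis
    by (simp only: poisson_def pd_wave_sum wave_sum_mult wave_sum_diff sum_subtractf[symmetric] p_def)
qed

lemma coeff_sum: "coeff (\<Sum>i\<in>A. f i) S = (\<Sum>i\<in>A. coeff (f i) S)"
  by (induction A rule: infinite_finite_induct) (simp_all add: zero_epsalg.rep_eq plus_epsalg.rep_eq)

section \<open>Tree sums of plane waves and the heavenly equation on each monomial\<close>

definition edge_weight ::
  "(nat \<Rightarrow> complex) \<Rightarrow> (nat \<Rightarrow> complex) \<Rightarrow> (nat \<Rightarrow> complex) \<Rightarrow> nat set \<Rightarrow> complex" where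
  "edge_weight \<omega> z zb e =
     \<omega> (Min e) * \<omega> (Max e) * (zb (Max e) - zb (Min e)) / (z (Min e) - z (Max e))"

text \<open>The case \<open>i = j\<close> is included, with both sides zero, so that double sums may
  run over the diagonal.\<close>

lemma edge_weight_doubleton:
  assumes "z i = z j \<Longrightarrow> i = j"
  shows "edge_weight \<omega> z zb {i, j} * (z i - z j) = \<omega> i * \<omega> j * (zb j - zb i)"
proof (cases i j rule: linorder_cases)
  case less
  then have "Min {i, j} = i" "Max {i, j} = j" "z i \<noteq> z j" using assms by auto
  then show ?thesis by (simp add: edge_weight_def)
next
  case greater
  then have "Min {i, j} = j" "Max {i, j} = i" "z j \<noteq> z i" using assms by auto
  then show ?thesis by (simp add: edge_weight_def divide_simps) (simp add: algebra_simps)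
qed simp

text \<open>A tree contributes only to the monomial of its own vertex set; grouping the trees by
  vertex set produces the tree sums.\<close>

lemma sum_tree_terms:
  "(\<lambda>X. \<Sum>t\<in>marked_trees N. tree_term z (plane_wave \<omega> z zb) t X)
     = wave_sum \<omega> z zb (\<lambda>S. if S \<subseteq> {1..N} then tree_sum (edge_weight \<omega> z zb) S else 0)"
proof (intro ext epsalg_eqI)
  fix X :: point and S :: "nat set" assume S: "finite S"
  let ?e = "\<lambda>S. exp (\<Sum>k\<in>S. \<i> * mom_dot \<omega> z zb k X)"
  let ?w = "edge_weight \<omega> z zb"
  have fin: "finite V" if "V \<in> Pow {1..N}" for V :: "nat set" using that finite_subset by auto
  have mt: "marked_trees N = (SIGMA V:Pow {1..N}. {E. is_tree V E})"
    by (auto simp: marked_trees_def)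
  have "coeff (\<Sum>t\<in>marked_trees N. tree_term z (plane_wave \<omega> z zb) t X) S
      = (\<Sum>(V, E)\<in>(SIGMA V:Pow {1..N}. {E. is_tree V E}).
          if V = S then (\<Prod>e\<in>E. ?w e) * ?e S else 0)"
    unfolding coeff_sum mt
  proof (rule sum.cong[OF refl], clarify)
    fix V E assume V: "V \<subseteq> {1..N}" and t: "is_tree V E"
    then have "finite V" using finite_subset by auto
    from tree_term_plane_wave[OF this] is_tree_edge[OF t]
    show "coeff (tree_term z (plane_wave \<omega> z zb) (V, E) X) S
        = (if V = S then (\<Prod>e\<in>E. ?w e) * ?e S else 0)"
      by (auto simp: edge_weight_def[abs_def] prod_plane_wave[OF \<open>finite V\<close>] scaleE.rep_eq
          coeff_prod_eps[OF \<open>finite V\<close>])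
  qed
  also have "\<dots> = (\<Sum>V\<in>Pow {1..N}. \<Sum>E | is_tree V E. if V = S then (\<Prod>e\<in>E. ?w e) * ?e S else 0)"
    by (rule sum.Sigma[symmetric]) (use fin finite_trees in auto)
  also have "\<dots> = (\<Sum>V\<in>Pow {1..N}. if V = S then tree_sum ?w S * ?e S else 0)"
    by (rule sum.cong) (auto simp: tree_sum_def sum_distrib_right)
  also have "\<dots> = coeff (wave_sum \<omega> z zb (\<lambda>S. if S \<subseteq> {1..N} then tree_sum ?w S else 0) X) S"
    using S by (simp add: wave_sum.rep_eq)
  finally show "coeff (\<Sum>t\<in>marked_trees N. tree_term z (plane_wave \<omega> z zb) t X) S = \<dots>" .
qed

text \<open>This is \<open>tree_sum_cut_square\<close> at the given \<open>z\<close>: multiplied by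
  z_i - z_j the edge weight loses its denominator, so both double sums become polynomials in the
  total momenta of \<open>T\<close>, \<open>S - T\<close> and \<open>S\<close>.\<close>

lemma tree_sum_plebanski:
  fixes \<omega> z zb :: "nat \<Rightarrow> complex"
  assumes S: "finite S" and inj: "inj_on z S"
  defines "A \<equiv> tree_sum (edge_weight \<omega> z zb)"
    and "p \<equiv> mom \<omega> z zb"
  shows "A S * (p CW S * p CWbar S - p CU S * p CUbar S)
    = (\<Sum>T\<in>Pow S. A T * A (S - T) * ((p CU T * p CW (S - T))\<^sup>2
          - p CU T * p CW T * p CU (S - T) * p CW (S - T)))"
    (is "_ = ?R")
proof -
  let ?w = "edge_weight \<omega> z zb"
  have w: "?w {i, j} * (z i - z j) = \<omega> i * \<omega> j * (zb j - zb i)" if "i \<in> S" "j \<in> S" for i j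
    by (rule edge_weight_doubleton) (use inj that in \<open>auto simp: inj_on_def\<close>)
  have h: "(\<Sum>i\<in>T. \<Sum>j\<in>S - T. ?w {i, j} * (z i - z j))
      = p CU (S - T) * p CW T - p CU T * p CW (S - T)" if T: "T \<subseteq> S" for T
  proof -
    have "(\<Sum>i\<in>T. \<Sum>j\<in>S - T. ?w {i, j} * (z i - z j))
        = (\<Sum>i\<in>T. \<Sum>j\<in>S - T. \<omega> i * (\<omega> j * zb j) - \<omega> i * zb i * \<omega> j)"
      by (intro sum.cong refl) (use T w in \<open>auto simp: algebra_simps\<close>)
    also have "\<dots> = p CU (S - T) * p CW T - p CU T * p CW (S - T)"
      by (simp add: p_def mom_def sum_subtractf sum_product[symmetric] sum_negf)
    finally show ?thesis .
  qed
  have q: "(\<Sum>i\<in>S. \<Sum>j\<in>S. ?w {i, j} * (z i - z j)\<^sup>2)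
      = 2 * (p CW S * p CWbar S - p CU S * p CUbar S)"
  proof -
    have "(\<Sum>i\<in>S. \<Sum>j\<in>S. ?w {i, j} * (z i - z j)\<^sup>2)
        = (\<Sum>i\<in>S. \<Sum>j\<in>S. \<omega> i * z i * (\<omega> j * zb j) - \<omega> i * (\<omega> j * z j * zb j)
            - \<omega> i * z i * zb i * \<omega> j + \<omega> i * zb i * (\<omega> j * z j))"
    proof (intro sum.cong refl)
      fix i j assume "i \<in> S" "j \<in> S"
      have "?w {i, j} * (z i - z j)\<^sup>2 = ?w {i, j} * (z i - z j) * (z i - z j)"
        by (simp add: power2_eq_square)
      also have "\<dots> = \<omega> i * \<omega> j * (zb j - zb i) * (z i - z j)"
        using w[OF \<open>i \<in> S\<close> \<open>j \<in> S\<close>] by simp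
      finally show "?w {i, j} * (z i - z j)\<^sup>2 = \<omega> i * z i * (\<omega> j * zb j) - \<omega> i * (\<omega> j * z j * zb j)
            - \<omega> i * z i * zb i * \<omega> j + \<omega> i * zb i * (\<omega> j * z j)"
        by (simp add: algebra_simps)
    qed
    also have "\<dots> = 2 * (p CW S * p CWbar S - p CU S * p CUbar S)"
      by (simp add: p_def mom_def sum_subtractf sum.distrib sum_product[symmetric] sum_negf)
    finally show ?thesis .
  qed
  \<comment> \<open>Exchanging \<open>T\<close> and \<open>S - T\<close> identifies the
    contributions of the two squares in the expanded bracket, which therefore amounts to
    \<open>?R\<close> twice; \<open>q\<close> supplies the matching factor 2.\<close>
  have flip: "(\<Sum>T\<in>Pow S. A T * A (S - T) * (p CU T * p CW (S - T))\<^sup>2)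
      = (\<Sum>T\<in>Pow S. A T * A (S - T) * (p CU (S - T) * p CW T)\<^sup>2)"
    by (rule sum.reindex_bij_witness[where i = "\<lambda>T. S - T" and j = "\<lambda>T. S - T"])
      (auto simp: double_diff mult.commute)
  have "2 * (A S * (p CW S * p CWbar S - p CU S * p CUbar S))
      = A S * (\<Sum>i\<in>S. \<Sum>j\<in>S. ?w {i, j} * (z i - z j)\<^sup>2)"
    by (simp add: q)
  also have "\<dots> = (\<Sum>T\<in>Pow S. A T * A (S - T) * (p CU (S - T) * p CW T - p CU T * p CW (S - T))\<^sup>2)"
    unfolding A_def tree_sum_cut_square[OF S, symmetric] by (rule sum.cong) (auto simp: h)
  also have "\<dots> = ?R + (\<Sum>T\<in>Pow S. A T * A (S - T) * ((p CU (S - T) * p CW T)\<^sup>2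
          - p CU T * p CW T * p CU (S - T) * p CW (S - T)))"
    unfolding sum.distrib[symmetric]
    by (rule sum.cong) (auto simp: power2_eq_square algebra_simps)
  also have "\<dots> = ?R + ?R"
    using flip by (simp add: right_diff_distrib sum_subtractf)
  finally show ?thesis by simp
qed

theorem theorem2p1:
  fixes N :: nat and \<omega> z zb :: "nat \<Rightarrow> complex"
  assumes "N \<ge> 1"
    and "\<forall>i\<in>{1..N}. \<omega> i \<noteq> 0"
    and "inj_on z {1..N}"
  shows "is_perturbiner N (plane_wave \<omega> z zb)
           (\<lambda>X. \<Sum>t\<in>marked_trees N. tree_term z (plane_wave \<omega> z zb) t X)"
proof -
  define A where "A = tree_sum (edge_weight \<omega> z zb)"
  define a where "a S = (if S \<subseteq> {1..N} then A S else 0)" for S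
  define p where "p = mom \<omega> z zb"
  define F where "F = wave_sum \<omega> z zb a"
  have field: "(\<lambda>X. \<Sum>t\<in>marked_trees N. tree_term z (plane_wave \<omega> z zb) t X) = F"
    unfolding F_def a_def A_def by (rule sum_tree_terms)
  have "F X \<in> eps_algebra N" for X
    by (auto simp: eps_algebra_def F_def a_def wave_sum.rep_eq)
  moreover have "smooth_field F" unfolding F_def by (rule smooth_wave_sum)
  moreover have "wave_op F X - poisson (pd CU F) (pd CW F) X = 0" for X
  proof (rule epsalg_eqI)
    fix S :: "nat set" assume S: "finite S"
    have eq: "a S * (p CW S * p CWbar S - p CU S * p CUbar S)
      = (\<Sum>T\<in>Pow S. a T * a (S - T) * ((p CU T * p CW (S - T))\<^sup>2
            - p CU T * p CW T * p CU (S - T) * p CW (S - T)))"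
    proof (cases "S \<subseteq> {1..N}")
      case True
      then have "inj_on z S" using assms(3) inj_on_subset by blast
      note eq = tree_sum_plebanski[OF S this, of \<omega> zb, folded A_def p_def]
      have "a T = A T" if "T \<subseteq> S" for T using that True by (auto simp: a_def)
      then have "a S = A S" "\<And>T. T \<in> Pow S \<Longrightarrow> a T * a (S - T) = A T * A (S - T)" by auto
      then show ?thesis by (simp only: eq cong: sum.cong)
    next
      case False
      \<comment> \<open>\<open>T\<close> and \<open>S - T\<close> cannot both lie in
        \<open>{1..N}\<close>, so every term of the convolution vanishes.\<close>
      then have "a T * a (S - T) = 0" if "T \<in> Pow S" for T
        using that by (auto simp: a_def)
      moreover have "a S = 0" using False by (simp add: a_def)
      ultimately show ?thesis by (simp add: sum.neutral del: mult_eq_0_iff)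
    qed
    show "coeff (wave_op F X - poisson (pd CU F) (pd CW F) X) S = coeff 0 S"
      unfolding F_def wave_op_wave_sum poisson_wave_sum wave_sum_diff
      using eq unfolding p_def by (simp add: wave_sum.rep_eq zero_epsalg.rep_eq)
  qed
  moreover have "linear_part (F X) = (\<Sum>i=1..N. plane_wave \<omega> z zb i X)" for X
  proof (rule epsalg_eqI)
    fix S :: "nat set"
    show "coeff (linear_part (F X)) S = coeff (\<Sum>i=1..N. plane_wave \<omega> z zb i X) S"
    \<comment> \<open>On a singleton the only tree is the bare vertex, of weight 1, which gives the
      seed. Otherwise both sides vanish; infinite \<open>S\<close>, with \<open>card\<close> 0, fall
      under this case.\<close>
    proof (cases "card S = 1")
      case True
      then obtain v where "S = {v}" by (auto simp: card_1_singleton_iff)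
      then show ?thesis
        by (simp add: linear_part.rep_eq F_def wave_sum.rep_eq coeff_sum plane_wave_def
            scaleE.rep_eq eps.rep_eq a_def A_def if_distrib cong: if_cong)
    next
      case False
      then show ?thesis
        by (auto simp: linear_part.rep_eq coeff_sum plane_wave_def scaleE.rep_eq eps.rep_eq
            intro!: sum.neutral)
    qed
  qed
  ultimately have "is_perturbiner N (plane_wave \<omega> z zb) F"
    by (simp add: is_perturbiner_def plebanski_solution_def)
  then show ?thesis unfolding field .
qed

end
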